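(* Let $M_t\ge 1$ and $1\le N<K$ be integers and $\rho>0$ a real number. Let $X_1,\dots,X_K$ be i.i.d. exponential random variables with mean $\rho$, let $X_{(1)}^{K}=\max_{1\le i\le K}X_i$, let $r_{th,N}=\rho\ln(K/N)$, and let $P_L=P\{X_{(1)}^{K}<r_{th,N}\}$. Fix $k\in\{1,\dots,K\}$ and define the sum rate loss $$\triangle R(K,N)=M_{t}\,\mathbb{E}\left\{\log(1+X_{(1)}^{K})-\log(1+X_{k}) \,\middle|\, X_{(1)}^{K}<r_{th,N}\right\}P_{L}.$$ Then $$\triangle R(K,N)\le M_{t}\log\left(1+\mathbb{E}\left\{X_{(1)}^{K}-X_{k} \,\middle|\, X_{(1)}^{K}<r_{th,N}\right\}\right)P_{L},$$ where $P_L=\left(1-\frac{N}{K}\right)^{K}$ and $$\mathbb{E}\left\{X_{(1)}^{K}-X_{k} \,\middle|\, X_{(1)}^{K}<r_{th,N}\right\}=\frac{\displaystyle\frac{K}{\rho}\sum_{t=0}^{K-1}\frac{(-1)^t(K-1)!}{t!\,(K-t-1)!}\left(\frac{1-\left(\frac{N}{K}\right)^{c_t\rho}}{c_t^2}-\frac{\rho\left(\ln\frac{K}{N}\right)\left(\frac{N}{K}\right)^{c_t\rho}}{c_t}\right)}{\left(1-\frac{N}{K}\right)^{K}}-\rho\left(1-\frac{\left(\ln\frac{K}{N}\right)\frac{N}{K}}{1-\frac{N}{K}}\right),$$ with $c_t=\frac{1+t}{\rho}$.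
   Context: Here $\log$ is the logarithm with base $2$ and $\ln$ the natural logarithm. Interpretation: $X_i$ is the SNR of user $i$ on a given transmit beam of a system with $M_t$ beams and $K$ users. A user feeds back only if its SNR is at least $r_{th,N}$. If nobody feeds back (the rate loss event, of probability $P_L$), an arbitrary user $k$ is scheduled instead of the best one. $\triangle R(K,N)$ is the resulting loss in sum rate compared with the system in which all users always feed back. *)

theory Defs
  imports "HOL-Probability.Probability"
begin

definition cond_expectation_on :: "'a measure \<Rightarrow> ('a \<Rightarrow> real) \<Rightarrow> 'a set \<Rightarrow> real" where
  "cond_expectation_on M Y A = integral\<^sup>L (uniform_measure M A) Y"

text \<open>Conditioning on an event of positive probability, this is the elementary conditional
  expectation.\<close>

lemma (in prob_space) cond_expectation_on_eq:
  assumes "A \<in> events" "prob A > 0" "Y \<in> borel_measurable M"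
  shows "cond_expectation_on M Y A = expectation (\<lambda>\<omega>. Y \<omega> * indicator A \<omega>) / prob A"
proof -
  have "uniform_measure M A = density M (\<lambda>x. ennreal (indicator A x / prob A))"
    unfolding uniform_measure_def using assms(2)
    by (intro arg_cong[of _ _ "density M"])
      (auto simp: emeasure_eq_measure divide_ennreal indicator_def simp flip: ennreal_1)
  then show ?thesis
    unfolding cond_expectation_on_def using assms
    by (simp add: integral_density mult.commute)
qed

definition max_snr :: "(nat \<Rightarrow> 'a \<Rightarrow> real) \<Rightarrow> nat \<Rightarrow> 'a \<Rightarrow> real" where
  "max_snr X K \<omega> = Max ((\<lambda>i. X i \<omega>) ` {1..K})"

definition fb_threshold :: "real \<Rightarrow> nat \<Rightarrow> nat \<Rightarrow> real" where
  "fb_threshold \<rho> K N = \<rho> * ln (real K / real N)"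

definition rate_loss_event ::
    "'a measure \<Rightarrow> (nat \<Rightarrow> 'a \<Rightarrow> real) \<Rightarrow> real \<Rightarrow> nat \<Rightarrow> nat \<Rightarrow> 'a set" where
  "rate_loss_event M X \<rho> K N = {\<omega> \<in> space M. max_snr X K \<omega> < fb_threshold \<rho> K N}"

definition rate_loss_prob ::
    "'a measure \<Rightarrow> (nat \<Rightarrow> 'a \<Rightarrow> real) \<Rightarrow> real \<Rightarrow> nat \<Rightarrow> nat \<Rightarrow> real" where
  "rate_loss_prob M X \<rho> K N = measure M (rate_loss_event M X \<rho> K N)"

definition sum_rate_loss ::
    "'a measure \<Rightarrow> (nat \<Rightarrow> 'a \<Rightarrow> real) \<Rightarrow> real \<Rightarrow> nat \<Rightarrow> nat \<Rightarrow> nat \<Rightarrow> nat \<Rightarrow> real" where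
  "sum_rate_loss M X \<rho> Mt k K N =
     real Mt *
     cond_expectation_on M (\<lambda>\<omega>. log 2 (1 + max_snr X K \<omega>) - log 2 (1 + X k \<omega>))
       (rate_loss_event M X \<rho> K N) *
     rate_loss_prob M X \<rho> K N"

definition rate_coeff :: "real \<Rightarrow> nat \<Rightarrow> real" where
  "rate_coeff \<rho> t = (1 + real t) / \<rho>"

end

theory Submission
  imports Defs
begin

text \<open>On the rate loss event \<open>0 \<le> X\<^sub>k \<le> X\<^sub>m\<^sub>a\<^sub>x\<close> holds almost surely, so
  \<open>log (1 + X\<^sub>m\<^sub>a\<^sub>x) - log (1 + X\<^sub>k) \<le> log (1 + (X\<^sub>m\<^sub>a\<^sub>x - X\<^sub>k))\<close>, and the bound is Jensen's inequality.
  The maximum has density \<open>K l exp (-l x) (1 - exp (-l x)) ^ (K - 1)\<close> with \<open>l = 1 / \<rho>\<close>, whose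
  binomial expansion gives the alternating sum; by independence the other variables contribute
  to the truncated mean of \<open>X\<^sub>k\<close> only factors that the conditioning cancels.\<close>

section \<open>Integrals and null sets for a single exponential variable\<close>

text \<open>The antiderivative is \<open>- (x / c + 1 / c\<^sup>2) * exp (- c * x)\<close>. Both
  truncated means rest on it: \<open>c = l\<close> for one variable, \<open>c = (1 + t) * l\<close>
  for each binomial term in the density of the maximum.\<close>

lemma has_bochner_integral_id_times_exp:
  fixes c r :: real
  assumes "c \<noteq> 0" "0 \<le> r"
  shows "has_bochner_integral lborel (\<lambda>x. x * exp (- c * x) * indicator {0..r} x)
           ((1 - exp (- c * r)) / c\<^sup>2 - r * exp (- c * r) / c)"
proof -
  let ?F = "\<lambda>x. - (x / c + 1 / c\<^sup>2) * exp (- c * x)"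
  have "has_bochner_integral lborel (\<lambda>x. x * exp (- c * x) * indicator {0..r} x) (?F r - ?F 0)"
  proof (rule has_bochner_integral_FTC_Icc_real[OF assms(2)])
    show "DERIV ?F x :> x * exp (- c * x)" for x
      using assms(1) by (auto intro!: derivative_eq_intros simp: field_simps power2_eq_square)
  qed (auto intro!: continuous_intros)
  moreover have "?F r - ?F 0 = (1 - exp (- c * r)) / c\<^sup>2 - r * exp (- c * r) / c"
    by (simp add: algebra_simps diff_divide_distrib)
  ultimately show ?thesis
    by simp
qed

text \<open>A density with respect to Lebesgue measure gives points no mass. This later lets the
  strict event \<open>Max < r\<close> be traded for \<open>Max \<le> r\<close>, the form that
  distribution functions describe.\<close>

lemma AE_distributed_lborel_neq:
  fixes X :: "'a \<Rightarrow> real"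
  assumes "distributed M lborel X f"
  shows "AE \<omega> in M. X \<omega> \<noteq> r"
proof -
  have X: "X \<in> borel_measurable M"
    using distributed_measurable[OF assms] by simp
  have "emeasure M (X -` {r} \<inter> space M) = (\<integral>\<^sup>+x. f x * indicator {r} x \<partial>lborel)"
    by (rule distributed_emeasure[OF assms]) simp
  also have "\<dots> = 0"
    by (intro nn_integral_zero' AE_I[where N = "{r}"]) (auto simp: indicator_def)
  finally show ?thesis
    using X by (intro AE_I[where N = "X -` {r} \<inter> space M"]) (auto simp: measurable_sets)
qed

lemma AE_exponential_nonneg:
  assumes D: "distributed M lborel X (exponential_density l)"
  shows "AE \<omega> in M. 0 \<le> X \<omega>"
proof -
  have X: "X \<in> borel_measurable M"
    using distributed_measurable[OF D] by simp
  have "emeasure M (X -` {..<0} \<inter> space M)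
      = (\<integral>\<^sup>+x. ennreal (exponential_density l x) * indicator {..<0} x \<partial>lborel)"
    by (rule distributed_emeasure[OF D]) simp
  also have "\<dots> = 0"
    by (intro nn_integral_zero' AE_I2) (auto simp: indicator_def exponential_density_def)
  finally show ?thesis
    using X by (intro AE_I[where N = "X -` {..<0} \<inter> space M"]) (auto simp: measurable_sets)
qed

lemma truncated_exponential_mean:
  assumes D: "distributed M lborel X (exponential_density l)" and "0 < l" "0 \<le> r"
  shows "(\<integral>\<omega>. X \<omega> * indicator {..r} (X \<omega>) \<partial>M) = (1 - exp (- l * r)) / l - r * exp (- l * r)"
proof -
  have "(\<integral>\<omega>. X \<omega> * indicator {..r} (X \<omega>) \<partial>M)
      = (\<integral>x. exponential_density l x * (x * indicator {..r} x) \<partial>lborel)"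
    using \<open>0 < l\<close> by (intro distributed_integral[OF D, symmetric]) (auto simp: exponential_density_nonneg)
  also have "\<dots> = (\<integral>x. l * (x * exp (- l * x) * indicator {0..r} x) \<partial>lborel)"
    by (intro Bochner_Integration.integral_cong)
       (auto simp: exponential_density_def indicator_def mult_ac)
  also have "\<dots> = l * ((1 - exp (- l * r)) / l\<^sup>2 - r * exp (- l * r) / l)"
    using has_bochner_integral_id_times_exp[of l r] assms
    by (simp add: has_bochner_integral_iff)
  also have "\<dots> = (1 - exp (- l * r)) / l - r * exp (- l * r)"
    using \<open>0 < l\<close> by (simp add: right_diff_distrib diff_divide_distrib power2_eq_square)
  finally show ?thesis .
qed

section \<open>Density of the maximum\<close>

text \<open>On the nonnegative half-line this is the derivative of
  \<open>(1 - exp (- l * x)) ^ n\<close>, the distribution function of the maximum of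
  \<open>n\<close> independent exponential variables of rate \<open>l\<close>.\<close>

definition max_exponential_density :: "nat \<Rightarrow> real \<Rightarrow> real \<Rightarrow> real" where
  "max_exponential_density n l x =
     (if x < 0 then 0 else real n * l * exp (- l * x) * (1 - exp (- l * x)) ^ (n - 1))"

lemma max_exponential_density_nonneg: "0 \<le> l \<Longrightarrow> 0 \<le> max_exponential_density n l x"
  by (auto simp: max_exponential_density_def)

lemma borel_measurable_max_exponential_density [measurable]:
  "max_exponential_density n l \<in> borel_measurable borel"
  unfolding max_exponential_density_def[abs_def] by measurable

section \<open>Expectations of products of independent variables\<close>

context prob_space
begin

text \<open>The bound supplies the integrability that the product rule requires. It is only almost
  sure because \<open>x * indicator {..r} x\<close> is unbounded below on the reals, while
  exponential variables are almost surely nonnegative. Letting \<open>h\<close> depend on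
  \<open>i\<close> allows one variable to be treated differently from the others.\<close>

lemma indep_vars_expectation_prod_bounded:
  fixes X :: "'i \<Rightarrow> 'a \<Rightarrow> real"
  assumes "finite I" "indep_vars (\<lambda>_. borel) X I"
    and "\<And>i. i \<in> I \<Longrightarrow> h i \<in> borel_measurable borel"
    and "\<And>i. i \<in> I \<Longrightarrow> AE \<omega> in M. \<bar>h i (X i \<omega>)\<bar> \<le> (B :: real)"
  shows "expectation (\<lambda>\<omega>. \<Prod>i\<in>I. h i (X i \<omega>)) = (\<Prod>i\<in>I. expectation (\<lambda>\<omega>. h i (X i \<omega>)))"
proof (rule indep_vars_lebesgue_integral)
  show "indep_vars (\<lambda>_. borel) (\<lambda>i \<omega>. h i (X i \<omega>)) I"
    by (rule indep_vars_compose2[OF assms(2)]) (use assms(3) in auto)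
  fix i assume i: "i \<in> I"
  have "X i \<in> borel_measurable M"
    using assms(2) i by (auto simp: indep_vars_def)
  then show "integrable M (\<lambda>\<omega>. h i (X i \<omega>))"
    using assms(3,4)[OF i] by (intro integrable_const_bound[where B = B]) auto
qed fact

lemma expectation_indicator_exponential_le:
  assumes D: "distributed M lborel X (exponential_density l)" and "0 < l" "0 \<le> a"
  shows "expectation (\<lambda>\<omega>. indicator {..a} (X \<omega>) :: real) = 1 - exp (- l * a)"
proof -
  have X [measurable]: "X \<in> borel_measurable M"
    using distributed_measurable[OF D] by simp
  have "expectation (\<lambda>\<omega>. indicator {..a} (X \<omega>) :: real)
      = expectation (indicator {\<omega> \<in> space M. X \<omega> \<le> a})"
    by (intro Bochner_Integration.integral_cong) (auto simp: indicator_def)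
  also have "\<dots> = prob {\<omega> \<in> space M. X \<omega> \<le> a}"
    by simp
  finally show ?thesis
    using exponential_distributedD_le[OF D \<open>0 \<le> a\<close> \<open>0 < l\<close>] by (simp add: mult.commute)
qed

section \<open>The maximum of finitely many i.i.d. exponential variables\<close>

context
  fixes X :: "'i \<Rightarrow> 'a \<Rightarrow> real" and I :: "'i set" and l :: real
  assumes I: "finite I" "I \<noteq> {}"
    and indep: "indep_vars (\<lambda>_. borel) X I"
    and D: "\<And>i. i \<in> I \<Longrightarrow> distributed M lborel (X i) (exponential_density l)"
    and l: "0 < l"
begin

lemma measurable_var: "i \<in> I \<Longrightarrow> X i \<in> borel_measurable M"
  using indep by (auto simp: indep_vars_def)

lemma measurable_Max: "(\<lambda>\<omega>. Max ((\<lambda>i. X i \<omega>) ` I)) \<in> borel_measurable M"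
  using I by (intro borel_measurable_Max) (auto intro: measurable_var)

text \<open>A maximum is at most \<open>a\<close> exactly when every element is. As a product over
  \<open>I\<close> the indicator becomes accessible to independence.\<close>

lemma indicator_Max_le_eq_prod:
  "indicator {..a} (Max ((\<lambda>i. X i \<omega>) ` I)) = (\<Prod>i\<in>I. indicator {..a} (X i \<omega>) :: real)"
proof (cases "\<forall>i\<in>I. X i \<omega> \<le> a")
  case True
  then show ?thesis using I by (simp add: indicator_def)
next
  case False
  then have "\<not> Max ((\<lambda>i. X i \<omega>) ` I) \<le> a"
    using I by simp
  moreover have "(\<Prod>i\<in>I. indicator {..a} (X i \<omega>) :: real) = 0"
    using False I by (intro prod_zero) (auto simp: indicator_def)
  ultimately show ?thesis
    by (simp add: indicator_def)
qed

lemma AE_vars_nonneg: "AE \<omega> in M. \<forall>i\<in>I. 0 \<le> X i \<omega>"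
  using AE_exponential_nonneg[OF D] I by (simp add: AE_finite_all)

text \<open>The maximum is attained by some \<open>X i\<close>, so hitting \<open>r\<close> forces
  one of finitely many null events.\<close>

lemma AE_Max_neq: "AE \<omega> in M. Max ((\<lambda>i. X i \<omega>) ` I) \<noteq> r"
proof -
  have "AE \<omega> in M. \<forall>i\<in>I. X i \<omega> \<noteq> r"
    using AE_distributed_lborel_neq[OF D] I by (simp add: AE_finite_all)
  then show ?thesis
  proof (rule AE_mp, intro AE_I2 impI)
    fix \<omega> assume "\<forall>i\<in>I. X i \<omega> \<noteq> r"
    moreover have "Max ((\<lambda>i. X i \<omega>) ` I) \<in> (\<lambda>i. X i \<omega>) ` I"
      using I by (intro Max_in) auto
    ultimately show "Max ((\<lambda>i. X i \<omega>) ` I) \<noteq> r"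
      by auto
  qed
qed

lemma expectation_indicator_Max_le:
  assumes "0 \<le> a"
  shows "expectation (\<lambda>\<omega>. indicator {..a} (Max ((\<lambda>i. X i \<omega>) ` I)) :: real)
           = (1 - exp (- l * a)) ^ card I"
proof -
  have "expectation (\<lambda>\<omega>. indicator {..a} (Max ((\<lambda>i. X i \<omega>) ` I)) :: real)
      = (\<Prod>i\<in>I. expectation (\<lambda>\<omega>. indicator {..a} (X i \<omega>)))"
    unfolding indicator_Max_le_eq_prod
    by (rule indep_vars_expectation_prod_bounded[where B = 1, OF I(1) indep])
       (auto simp: indicator_def)
  also have "\<dots> = (\<Prod>i\<in>I. 1 - exp (- l * a))"
    using expectation_indicator_exponential_le[OF D l assms] by (intro prod.cong) auto
  finally show ?thesis
    by simp
qed

lemma prob_Max_le: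
  assumes "0 \<le> a"
  shows "prob {\<omega> \<in> space M. Max ((\<lambda>i. X i \<omega>) ` I) \<le> a} = (1 - exp (- l * a)) ^ card I"
proof -
  note measurable_Max[measurable]
  have "prob {\<omega> \<in> space M. Max ((\<lambda>i. X i \<omega>) ` I) \<le> a}
      = expectation (indicator {\<omega> \<in> space M. Max ((\<lambda>i. X i \<omega>) ` I) \<le> a})"
    by simp
  also have "\<dots> = expectation (\<lambda>\<omega>. indicator {..a} (Max ((\<lambda>i. X i \<omega>) ` I)) :: real)"
    by (intro Bochner_Integration.integral_cong) (auto simp: indicator_def)
  finally show ?thesis
    using expectation_indicator_Max_le[OF assms] by simp
qed

text \<open>The distribution function obtained from independence is the integral of the density: by
  the fundamental theorem of calculus on \<open>{0..a}\<close>, and for \<open>a < 0\<close> because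
  both sides vanish.\<close>

lemma distributed_Max:
  "distributed M lborel (\<lambda>\<omega>. Max ((\<lambda>i. X i \<omega>) ` I)) (max_exponential_density (card I) l)"
proof (rule distributedI_borel_atMost[where g = "\<lambda>a. if a < 0 then 0 else (1 - exp (- l * a)) ^ card I"])
  let ?g = "\<lambda>a. if a < 0 then 0 else (1 - exp (- l * a)) ^ card I"
  \<comment> \<open>The antiderivative used below takes the value \<open>0 ^ card I\<close> at
    \<open>0\<close>, which vanishes only for a nonempty index set.\<close>
  have n: "card I > 0"
    using I by (simp add: card_gt_0_iff)
  show "(\<integral>\<^sup>+x. ennreal (max_exponential_density (card I) l x * indicator {..a} x) \<partial>lborel)
      = ennreal (?g a)" for a
  proof (cases "a < 0")
    case True
    then show ?thesis
      by (simp, intro nn_integral_zero' AE_I2)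
         (auto simp: indicator_def max_exponential_density_def)
  next
    case False
    let ?h = "\<lambda>x. real (card I) * l * exp (- l * x) * (1 - exp (- l * x)) ^ (card I - 1)"
    let ?F = "\<lambda>x. (1 - exp (- l * x)) ^ card I"
    have "(\<integral>\<^sup>+x. ennreal (max_exponential_density (card I) l x * indicator {..a} x) \<partial>lborel)
        = (\<integral>\<^sup>+x. ennreal (?h x) * indicator {0..a} x \<partial>lborel)"
      by (intro nn_integral_cong) (auto simp: indicator_def max_exponential_density_def)
    also have "\<dots> = ?F a - ?F 0"
    proof (rule nn_integral_FTC_Icc)
      show "DERIV ?F x :> ?h x" for x
        by (auto intro!: derivative_eq_intros)
    qed (use False l in auto)
    finally show ?thesis
      using False n by (simp add: zero_power)
  qed
  show "emeasure M {\<omega> \<in> space M. Max ((\<lambda>i. X i \<omega>) ` I) \<le> a} = ennreal (?g a)" for a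
  proof (cases "a < 0")
    case True
    note measurable_Max[measurable]
    have "AE \<omega> in M. \<not> Max ((\<lambda>i. X i \<omega>) ` I) \<le> a"
      using AE_vars_nonneg
    proof eventually_elim
      case (elim \<omega>)
      \<comment> \<open>Any one nonnegative variable already pushes the maximum above the negative
        \<open>a\<close>.\<close>
      obtain i where "i \<in> I"
        using I by blast
      moreover from this have "a < X i \<omega>"
        using elim True by fastforce
      ultimately show ?case
        using I by (auto simp: not_le)
    qed
    then have "emeasure M {\<omega> \<in> space M. Max ((\<lambda>i. X i \<omega>) ` I) \<le> a} = 0"
      by (subst (asm) AE_iff_measurable[OF _ refl]) auto
    with True show ?thesis by simp
  next
    case False
    then show ?thesis
      using prob_Max_le[of a] by (simp add: emeasure_eq_measure)
  qed
qed (use l in \<open>auto simp: max_exponential_density_nonneg measurable_Max\<close>)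

text \<open>Expanding the power in the density by the binomial theorem turns the integrand into a
  signed sum of terms \<open>x * exp (- c t * x)\<close>, which are integrated one by one over
  \<open>{0..r}\<close>.\<close>

lemma truncated_Max_mean:
  assumes "0 \<le> r"
  defines "c \<equiv> \<lambda>t. (1 + real t) * l"
  shows "expectation (\<lambda>\<omega>. Max ((\<lambda>i. X i \<omega>) ` I) * indicator {..r} (Max ((\<lambda>i. X i \<omega>) ` I)))
           = real (card I) * l * (\<Sum>t = 0..card I - 1. (-1) ^ t * real (card I - 1 choose t) *
               ((1 - exp (- c t * r)) / (c t)\<^sup>2 - r * exp (- c t * r) / c t))"
proof -
  have expand: "(1 - exp (- l * x)) ^ m = (\<Sum>t\<le>m. (-1) ^ t * real (m choose t) * exp (- l * x) ^ t)"
    for x m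
    using binomial_ring[of "- exp (- l * x)" 1 m]
    by (simp add: mult_ac power_minus[of "exp _"] add.commute)
  \<comment> \<open>The factor \<open>exp (- l * x)\<close> already present in the density raises
    the rate from \<open>t * l\<close> to \<open>(1 + t) * l\<close>; this is the shift in
    \<open>c\<close>.\<close>
  have c: "exp (- l * x) * exp (- l * x) ^ t = exp (- c t * x)" for x t
    by (simp add: c_def exp_of_nat_mult[symmetric] exp_add[symmetric] algebra_simps)
  have "expectation (\<lambda>\<omega>. Max ((\<lambda>i. X i \<omega>) ` I) * indicator {..r} (Max ((\<lambda>i. X i \<omega>) ` I)))
      = (\<integral>x. max_exponential_density (card I) l x * (x * indicator {..r} x) \<partial>lborel)"
    using l by (intro distributed_integral[OF distributed_Max, symmetric])
      (auto simp: max_exponential_density_nonneg)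
  also have "\<dots> = (\<integral>x. real (card I) * l * (\<Sum>t = 0..card I - 1. (-1) ^ t *
      real (card I - 1 choose t) * (x * exp (- c t * x) * indicator {0..r} x)) \<partial>lborel)"
  proof (intro Bochner_Integration.integral_cong refl)
    fix x :: real
    show "max_exponential_density (card I) l x * (x * indicator {..r} x)
        = real (card I) * l * (\<Sum>t = 0..card I - 1. (-1) ^ t *
            real (card I - 1 choose t) * (x * exp (- c t * x) * indicator {0..r} x))"
    proof (cases "0 \<le> x \<and> x \<le> r")
      case True
      then have "max_exponential_density (card I) l x * (x * indicator {..r} x)
          = real (card I) * l * (\<Sum>t\<le>card I - 1. (-1) ^ t * real (card I - 1 choose t) *
              (x * (exp (- l * x) * exp (- l * x) ^ t)))"
        unfolding max_exponential_density_def expand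
        by (simp add: sum_distrib_left sum_distrib_right mult_ac)
      then show ?thesis
        unfolding c using True by (simp add: atMost_atLeast0)
    qed (auto simp: max_exponential_density_def indicator_def)
  qed
  also have "\<dots> = real (card I) * l * (\<Sum>t = 0..card I - 1. (-1) ^ t *
      real (card I - 1 choose t) * ((1 - exp (- c t * r)) / (c t)\<^sup>2 - r * exp (- c t * r) / c t))"
  proof (intro has_bochner_integral_integral_eq has_bochner_integral_mult_right
      has_bochner_integral_sum has_bochner_integral_id_times_exp assms)
    show "c t \<noteq> 0" for t
      using l by (simp add: c_def add_nonneg_eq_0_iff)
  qed
  finally show ?thesis .
qed

text \<open>Truncating the maximum truncates every variable separately, so independence splits the
  expectation: \<open>X k\<close> contributes its own truncated mean, each of the other
  \<open>card I - 1\<close> variables its probability of staying at most \<open>r\<close>.\<close>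

lemma truncated_var_mean:
  assumes k: "k \<in> I" and r: "0 \<le> r"
  shows "expectation (\<lambda>\<omega>. X k \<omega> * indicator {..r} (Max ((\<lambda>i. X i \<omega>) ` I)))
           = ((1 - exp (- l * r)) / l - r * exp (- l * r)) * (1 - exp (- l * r)) ^ (card I - 1)"
proof -
  define h :: "'i \<Rightarrow> real \<Rightarrow> real"
    where "h i x = (if i = k then x * indicator {..r} x else indicator {..r} x)" for i x
  have "X k \<omega> * indicator {..r} (Max ((\<lambda>i. X i \<omega>) ` I)) = (\<Prod>i\<in>I. h i (X i \<omega>))" for \<omega>
  proof -
    have "(\<Prod>i\<in>I - {k}. h i (X i \<omega>)) = (\<Prod>i\<in>I - {k}. indicator {..r} (X i \<omega>))"
      by (intro prod.cong) (auto simp: h_def)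
    then show ?thesis
      unfolding indicator_Max_le_eq_prod prod.remove[OF I(1) k] by (simp add: h_def)
  qed
  then have "expectation (\<lambda>\<omega>. X k \<omega> * indicator {..r} (Max ((\<lambda>i. X i \<omega>) ` I)))
      = expectation (\<lambda>\<omega>. \<Prod>i\<in>I. h i (X i \<omega>))"
    by simp
  also have "\<dots> = (\<Prod>i\<in>I. expectation (\<lambda>\<omega>. h i (X i \<omega>)))"
  \<comment> \<open>The value \<open>1\<close> bounds the plain indicators, and \<open>r\<close>
    bounds the truncated \<open>X k\<close> wherever that variable is nonnegative.\<close>
  proof (rule indep_vars_expectation_prod_bounded[where B = "max 1 r", OF I(1) indep])
    fix i assume "i \<in> I"
    from AE_exponential_nonneg[OF D[OF this]]
    show "AE \<omega> in M. \<bar>h i (X i \<omega>)\<bar> \<le> max 1 r"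
      by eventually_elim (auto simp: h_def indicator_def)
  qed (auto simp: h_def)
  also have "\<dots> = expectation (\<lambda>\<omega>. h k (X k \<omega>)) * (\<Prod>i\<in>I - {k}. expectation (\<lambda>\<omega>. h i (X i \<omega>)))"
    by (rule prod.remove[OF I(1) k])
  also have "expectation (\<lambda>\<omega>. h k (X k \<omega>)) = (1 - exp (- l * r)) / l - r * exp (- l * r)"
    using truncated_exponential_mean[OF D[OF k] l r] by (simp add: h_def)
  also have "(\<Prod>i\<in>I - {k}. expectation (\<lambda>\<omega>. h i (X i \<omega>))) = (\<Prod>i\<in>I - {k}. 1 - exp (- l * r))"
    using expectation_indicator_exponential_le[OF D l r] by (intro prod.cong) (auto simp: h_def)
  finally show ?thesis
    using k I by simp
qed

end

section \<open>Jensen's inequality conditioned on an event\<close>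

text \<open>The tangent line of the concave function \<open>log 2 (1 + y)\<close> at the conditional
  mean \<open>m\<close> lies above it and is integrated over \<open>A\<close>. Keeping
  \<open>L\<close> separate from \<open>log 2 (1 + Y)\<close> combines a pointwise estimate on
  \<open>A\<close> with Jensen's inequality.\<close>

lemma jensen_log_on_event:
  assumes A: "A \<in> events" "prob A > 0"
    and Y: "integrable M (\<lambda>\<omega>. Y \<omega> * indicator A \<omega>)"
    and L: "integrable M (\<lambda>\<omega>. L \<omega> * indicator A \<omega>)"
    and nonneg: "AE \<omega> in M. \<omega> \<in> A \<longrightarrow> 0 \<le> Y \<omega>"
    and le: "AE \<omega> in M. \<omega> \<in> A \<longrightarrow> L \<omega> \<le> log 2 (1 + Y \<omega>)"
  defines "m \<equiv> expectation (\<lambda>\<omega>. Y \<omega> * indicator A \<omega>) / prob A"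
  shows "expectation (\<lambda>\<omega>. L \<omega> * indicator A \<omega>) / prob A \<le> log 2 (1 + m)"
proof -
  have m: "0 \<le> m"
    unfolding m_def using nonneg
    by (intro divide_nonneg_nonneg integral_nonneg_AE) (auto simp: indicator_def)
  \<comment> \<open>This is \<open>ln z \<le> z - 1\<close> at
    \<open>z = (1 + y) / (1 + m)\<close>.\<close>
  have tangent: "log 2 (1 + y) \<le> log 2 (1 + m) + (y - m) / ((1 + m) * ln 2)" if "0 \<le> y" for y
  proof -
    have "ln ((1 + y) / (1 + m)) \<le> (1 + y) / (1 + m) - 1"
      using m that by (intro ln_le_minus_one) auto
    then have "ln (1 + y) \<le> ln (1 + m) + (y - m) / (1 + m)"
      using m that by (simp add: ln_div field_simps)
    then have "ln (1 + y) / ln 2 \<le> (ln (1 + m) + (y - m) / (1 + m)) / ln 2"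
      by (intro divide_right_mono) auto
    then show ?thesis
      by (simp add: log_def add_divide_distrib)
  qed
  let ?a = "log 2 (1 + m)" and ?b = "1 / ((1 + m) * ln 2)"
  have int: "integrable M (\<lambda>\<omega>. indicator A \<omega> :: real)"
    using A by (simp add: emeasure_eq_measure)
  have "expectation (\<lambda>\<omega>. L \<omega> * indicator A \<omega>)
      \<le> expectation (\<lambda>\<omega>. (?a - ?b * m) * indicator A \<omega> + ?b * (Y \<omega> * indicator A \<omega>))"
  proof (rule integral_mono_AE[OF L])
    show "integrable M (\<lambda>\<omega>. (?a - ?b * m) * indicator A \<omega> + ?b * (Y \<omega> * indicator A \<omega>))"
      using Y int by (intro Bochner_Integration.integrable_add integrable_mult_right)
    from nonneg le show "AE \<omega> in M. L \<omega> * indicator A \<omega>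
        \<le> (?a - ?b * m) * indicator A \<omega> + ?b * (Y \<omega> * indicator A \<omega>)"
    proof eventually_elim
      case (elim \<omega>)
      show ?case
        using elim tangent[of "Y \<omega>"] by (auto simp: indicator_def diff_divide_distrib)
    qed
  qed
  also have "\<dots> = (?a - ?b * m) * prob A + ?b * expectation (\<lambda>\<omega>. Y \<omega> * indicator A \<omega>)"
    using Y int A by (subst Bochner_Integration.integral_add) auto
  also have "expectation (\<lambda>\<omega>. Y \<omega> * indicator A \<omega>) = m * prob A"
    using A by (simp add: m_def)
  \<comment> \<open>The slope terms cancel because the tangent touches at the mean of
    \<open>Y\<close> over \<open>A\<close>.\<close>
  also have "(?a - ?b * m) * prob A + ?b * (m * prob A) = ?a * prob A"
    by (simp add: algebra_simps)
  finally show ?thesis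
    using A by (simp add: divide_le_eq)
qed

end

section \<open>The sum rate loss bound and its closed forms\<close>

theorem mainTheorem2:
  fixes M :: "'a measure" and X :: "nat \<Rightarrow> 'a \<Rightarrow> real"
    and Mt K N k :: nat and \<rho> :: real
  assumes "prob_space M"
    and "Mt \<ge> 1" and "1 \<le> N" and "N < K" and "\<rho> > 0"
    and "prob_space.indep_vars M (\<lambda>_. borel) X {1..K}"
    \<comment> \<open>\<open>exponential_density\<close> takes the rate, so mean \<open>\<rho>\<close> is rate \<open>1 / \<rho>\<close>\<close>
    and "\<And>i. i \<in> {1..K} \<Longrightarrow> distributed M lborel (X i) (exponential_density (1 / \<rho>))"
    and "k \<in> {1..K}"
  shows "sum_rate_loss M X \<rho> Mt k K N
           \<le> real Mt * log 2 (1 + cond_expectation_on M (\<lambda>\<omega>. max_snr X K \<omega> - X k \<omega>)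
                                    (rate_loss_event M X \<rho> K N))
               * rate_loss_prob M X \<rho> K N
       \<and> rate_loss_prob M X \<rho> K N = (1 - real N / real K) ^ K
       \<and> cond_expectation_on M (\<lambda>\<omega>. max_snr X K \<omega> - X k \<omega>) (rate_loss_event M X \<rho> K N) =
           (real K / \<rho> *
              (\<Sum>t = 0..K - 1.
                 (-1) ^ t * fact (K - 1) / (fact t * fact (K - t - 1)) *
                 ((1 - (real N / real K) powr (rate_coeff \<rho> t * \<rho>)) / (rate_coeff \<rho> t)\<^sup>2
                  - \<rho> * ln (real K / real N) * (real N / real K) powr (rate_coeff \<rho> t * \<rho>)
                      / rate_coeff \<rho> t)))
             / (1 - real N / real K) ^ K
           - \<rho> * (1 - ln (real K / real N) * (real N / real K) / (1 - real N / real K))"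
proof -
  interpret prob_space M by fact
  define I where "I = {1..K}"
  define l where "l = 1 / \<rho>"
  define r where "r = fb_threshold \<rho> K N"
  define q where "q = real N / real K"
  define A where "A = rate_loss_event M X \<rho> K N"
  define Z where "Z = max_snr X K"
  have I: "finite I" "I \<noteq> {}" "card I = K" and k: "k \<in> I"
    using assms by (auto simp: I_def)
  have l: "0 < l" and D: "\<And>i. i \<in> I \<Longrightarrow> distributed M lborel (X i) (exponential_density l)"
    and indep: "indep_vars (\<lambda>_. borel) X I"
    using assms by (auto simp: l_def I_def)
  note iid = I(1,2) indep D l
  have Z_eq: "Z = (\<lambda>\<omega>. Max ((\<lambda>i. X i \<omega>) ` I))"
    by (auto simp: Z_def max_snr_def I_def)
  have q: "0 < q" "q < 1"
    using assms by (auto simp: q_def)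
  have r_eq: "r = \<rho> * - ln q"
    using assms by (simp add: r_def fb_threshold_def q_def ln_div)
  have r: "0 \<le> r"
    using q assms by (simp add: r_eq mult_nonneg_nonpos)
  \<comment> \<open>The threshold is the level that a single variable exceeds with probability
    \<open>q = N / K\<close>, so the exponentials in the general formulas become powers of
    \<open>q\<close>.\<close>
  have exp_lr: "exp (- l * r) = q"
    using q assms by (simp add: l_def r_eq)
  have Z_meas [measurable]: "Z \<in> borel_measurable M"
    unfolding Z_eq by (rule measurable_Max[OF iid])
  have X_meas [measurable]: "X k \<in> borel_measurable M"
    by (rule measurable_var[OF iid k])
  have A_eq: "A = {\<omega> \<in> space M. Z \<omega> < r}"
    by (simp add: A_def rate_loss_event_def Z_def r_def)
  have A: "A \<in> events"
    unfolding A_eq by measurable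
  \<comment> \<open>\<open>A\<close> is given by a strict inequality, the truncated expectations by
    \<open>\<le>\<close>; the two differ only on the null event \<open>Z = r\<close>.\<close>
  have ind: "AE \<omega> in M. indicator A \<omega> = (indicator {..r} (Z \<omega>) :: real)"
    using AE_Max_neq[OF iid, of r]
    by (rule AE_mp) (auto intro!: AE_I2 simp: A_eq Z_eq indicator_def less_le)
  have "AE \<omega> in M. \<forall>i\<in>I. 0 \<le> X i \<omega>"
    by (rule AE_vars_nonneg[OF iid])
  then have bounds: "AE \<omega> in M. 0 \<le> X k \<omega> \<and> X k \<omega> \<le> Z \<omega>"
    by eventually_elim (use I k in \<open>auto simp: Z_eq intro!: Max_ge\<close>)
  have E_ind: "expectation (\<lambda>\<omega>. f \<omega> * indicator A \<omega>) = expectation (\<lambda>\<omega>. f \<omega> * indicator {..r} (Z \<omega>))"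
    if [measurable]: "f \<in> borel_measurable M" for f :: "'a \<Rightarrow> real"
  proof -
    note A[measurable]
    show ?thesis
      using ind by (intro integral_cong_AE) (auto elim!: eventually_mono)
  qed
  have pA: "prob A = (1 - q) ^ K"
    using E_ind[of "\<lambda>_. 1"] expectation_indicator_Max_le[OF iid r] A
    unfolding exp_lr by (simp add: Z_eq I)
  have pA_pos: "prob A > 0"
    using q by (simp add: pA)

  have int_Z: "integrable M (\<lambda>\<omega>. Z \<omega> * indicator A \<omega>)"
    and int_X: "integrable M (\<lambda>\<omega>. X k \<omega> * indicator A \<omega>)"
  proof -
    have bound: "AE \<omega> in M. norm (Z \<omega> * indicator A \<omega>) \<le> r" "AE \<omega> in M. norm (X k \<omega> * indicator A \<omega>) \<le> r"
      using bounds by (eventually_elim, use r in \<open>auto simp: A_eq indicator_def\<close>)+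
    show "integrable M (\<lambda>\<omega>. Z \<omega> * indicator A \<omega>)" "integrable M (\<lambda>\<omega>. X k \<omega> * indicator A \<omega>)"
      using A by (auto intro: integrable_const_bound[OF bound(1)] integrable_const_bound[OF bound(2)])
  qed
  \<comment> \<open>Almost surely on \<open>A\<close>, \<open>0 \<le> X k \<le> Z < r\<close>, so
    monotonicity puts the difference of logarithms between \<open>0\<close> and
    \<open>log 2 (1 + r)\<close>.\<close>
  have int_L: "integrable M (\<lambda>\<omega>. (log 2 (1 + Z \<omega>) - log 2 (1 + X k \<omega>)) * indicator A \<omega>)"
  proof (rule integrable_const_bound[where B = "log 2 (1 + r)"])
    show "AE \<omega> in M. norm ((log 2 (1 + Z \<omega>) - log 2 (1 + X k \<omega>)) * indicator A \<omega>) \<le> log 2 (1 + r)"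
      using bounds
    proof eventually_elim
      case (elim \<omega>)
      show ?case
      proof (cases "\<omega> \<in> A")
        case True
        then have "0 \<le> log 2 (1 + X k \<omega>)" "log 2 (1 + X k \<omega>) \<le> log 2 (1 + Z \<omega>)"
          "log 2 (1 + Z \<omega>) \<le> log 2 (1 + r)"
          using elim by (auto simp: A_eq)
        then show ?thesis
          using True by simp
      qed (use r in simp)
    qed
  qed (use A in measurable)

  have Jensen: "cond_expectation_on M (\<lambda>\<omega>. log 2 (1 + Z \<omega>) - log 2 (1 + X k \<omega>)) A
      \<le> log 2 (1 + cond_expectation_on M (\<lambda>\<omega>. Z \<omega> - X k \<omega>) A)"
    using A pA_pos
  proof (simp only: cond_expectation_on_eq Z_meas X_meas borel_measurable_diff borel_measurable_log
      borel_measurable_add borel_measurable_const, intro jensen_log_on_event)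
    show "integrable M (\<lambda>\<omega>. (Z \<omega> - X k \<omega>) * indicator A \<omega>)"
      using Bochner_Integration.integrable_diff[OF int_Z int_X] by (simp add: left_diff_distrib)
    show "AE \<omega> in M. \<omega> \<in> A \<longrightarrow> 0 \<le> Z \<omega> - X k \<omega>"
      using bounds by eventually_elim simp
    show "AE \<omega> in M. \<omega> \<in> A \<longrightarrow> log 2 (1 + Z \<omega>) - log 2 (1 + X k \<omega>) \<le> log 2 (1 + (Z \<omega> - X k \<omega>))"
      using bounds
    proof eventually_elim
      case (elim \<omega>)
      \<comment> \<open>This is exactly the amount by which
        \<open>(1 + (Z - X k)) * (1 + X k)\<close> exceeds \<open>1 + Z\<close>.\<close>
      have "0 \<le> X k \<omega> * (Z \<omega> - X k \<omega>)"
        using elim by simp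
      then have "1 + Z \<omega> \<le> (1 + (Z \<omega> - X k \<omega>)) * (1 + X k \<omega>)"
        by (simp add: algebra_simps)
      then have "log 2 (1 + Z \<omega>) \<le> log 2 ((1 + (Z \<omega> - X k \<omega>)) * (1 + X k \<omega>))"
        using elim by simp
      also have "\<dots> = log 2 (1 + (Z \<omega> - X k \<omega>)) + log 2 (1 + X k \<omega>)"
        using elim by (intro log_mult_pos) auto
      finally show ?case
        by simp
    qed
  qed (use int_L in auto)

  have EX: "expectation (\<lambda>\<omega>. X k \<omega> * indicator A \<omega>) / prob A
      = \<rho> * (1 - ln (real K / real N) * q / (1 - q))"
  proof -
    have "expectation (\<lambda>\<omega>. X k \<omega> * indicator A \<omega>) = ((1 - q) / l - r * q) * (1 - q) ^ (K - 1)"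
      using truncated_var_mean[OF iid k r] unfolding E_ind[OF X_meas] exp_lr by (simp add: Z_eq I)
    \<comment> \<open>One factor is split off, using \<open>K > 0\<close>, so that the contribution
      \<open>(1 - q) ^ (K - 1)\<close> of the other users cancels against
      \<open>prob A\<close>.\<close>
    moreover have "(1 - q) ^ K = (1 - q) * (1 - q) ^ (K - 1)"
      using assms by (simp add: power_eq_if)
    ultimately have "expectation (\<lambda>\<omega>. X k \<omega> * indicator A \<omega>) / prob A = ((1 - q) / l - r * q) / (1 - q)"
      using q by (simp add: pA)
    then show ?thesis
      using q by (simp add: l_def r_def fb_threshold_def field_simps)
  qed

  have EZ: "expectation (\<lambda>\<omega>. Z \<omega> * indicator A \<omega>) = real K / \<rho> *
      (\<Sum>t = 0..K - 1. (-1) ^ t * fact (K - 1) / (fact t * fact (K - t - 1)) *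
        ((1 - q powr (rate_coeff \<rho> t * \<rho>)) / (rate_coeff \<rho> t)\<^sup>2
          - \<rho> * ln (real K / real N) * q powr (rate_coeff \<rho> t * \<rho>) / rate_coeff \<rho> t))"
  proof -
    have c: "(1 + real t) * l = rate_coeff \<rho> t" for t
      by (simp add: rate_coeff_def l_def)
    \<comment> \<open>The exponent on the right equals \<open>1 + t\<close> but is a real expression
      in the statement, hence \<open>powr\<close>.\<close>
    have e: "exp (- rate_coeff \<rho> t * r) = q powr (rate_coeff \<rho> t * \<rho>)" for t
      using q by (simp add: powr_def r_eq mult_ac)
    \<comment> \<open>The factorial quotient is a binomial coefficient because
      \<open>t \<le> K - 1\<close> throughout the sum. The abstract \<open>S\<close> lets the
      equation rewrite the sum without touching the bracketed terms.\<close>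
    have b: "(\<Sum>t = 0..K - 1. (-1) ^ t * fact (K - 1) / (fact t * fact (K - t - 1)) * S t)
        = (\<Sum>t = 0..K - 1. (-1) ^ t * real (K - 1 choose t) * S t)" for S :: "nat \<Rightarrow> real"
    proof (intro sum.cong refl)
      fix t assume "t \<in> {0..K - 1}"
      then show "(-1) ^ t * fact (K - 1) / (fact t * fact (K - t - 1)) * S t
          = (-1) ^ t * real (K - 1 choose t) * S t"
        by (simp add: binomial_fact)
    qed
    show ?thesis
      using truncated_Max_mean[OF iid r] unfolding E_ind[OF Z_meas] c e b
      by (simp add: Z_eq I l_def r_def fb_threshold_def)
  qed

  have E: "cond_expectation_on M (\<lambda>\<omega>. Z \<omega> - X k \<omega>) A
      = expectation (\<lambda>\<omega>. Z \<omega> * indicator A \<omega>) / prob A - expectation (\<lambda>\<omega>. X k \<omega> * indicator A \<omega>) / prob A"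
    using A pA_pos int_Z int_X
    by (simp add: cond_expectation_on_eq left_diff_distrib diff_divide_distrib)

  have bound: "sum_rate_loss M X \<rho> Mt k K N
      \<le> real Mt * log 2 (1 + cond_expectation_on M (\<lambda>\<omega>. Z \<omega> - X k \<omega>) A) * prob A"
    unfolding sum_rate_loss_def rate_loss_prob_def A_def[symmetric] Z_def[symmetric]
    using Jensen by (intro mult_right_mono mult_left_mono) auto

  show ?thesis
    using bound E[unfolded EX EZ, unfolded pA] pA
    unfolding rate_loss_prob_def A_def[symmetric] Z_def[symmetric] q_def[symmetric] by blast
qed

end
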